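(* Cutoff for $\mathcal{F}_c$ does not imply cutoff for $\mathcal{F}^{\mathcal{P}}_c$, nor conversely. That is: (a) there exist a family $\mathcal{F}=(\mathcal{X}_n,K_n,\pi_n)_{n=1}^\infty$ of irreducible Markov chains and a sequence $\mathcal{P}=(p_n)_{n=1}^\infty$ of positive reals such that $\mathcal{F}_c$ has no cutoff in the total variation but $\mathcal{F}^{\mathcal{P}}_c$ has a cutoff in the total variation; (b) there exist a family $\mathcal{F}=(\mathcal{X}_n,K_n,\pi_n)_{n=1}^\infty$ of irreducible Markov chains and a sequence $\mathcal{P}=(p_n)_{n=1}^\infty$ of positive reals such that $\mathcal{F}_c$ has a cutoff in the total variation but $\mathcal{F}^{\mathcal{P}}_c$ has no cutoff in the total variation.
   Context: A Markov chain $(\mathcal{X},K,\pi)$ has countable state space, irreducible stochastic matrix $K$ and stationary distribution $\pi$; the associated continuous time chain is $(\mathcal{X},H_t,\pi)$ with $H_t=e^{-t(I-K)}$. A subscript $c$ on a family denotes the family of associated continuous time chains. $\mathcal{F}^{\mathcal{P}}=(\mathcal{Y}_n,L_n,\nu_n)_{n=1}^\infty$, where with $q_n=p_1+\cdots+p_n$: $\mathcal{Y}_n=\mathcal{X}_1\times\cdots\times\mathcal{X}_n$, $\nu_n=\pi_1\times\cdots\times\pi_n$ and $L_n=\sum_{i=1}^n\frac{p_i}{q_n}I_1\otimes\cdots\otimes I_{i-1}\otimes K_i\otimes I_{i+1}\otimes\cdots\otimes I_n$ ($I_j$ the identity matrix indexed by $\mathcal{X}_j$). For a family of continuous time chains $(\mathcal{X}_n,H_{n,t},\pi_n)_n$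 put $d_n(t)=\sup_{x\in\mathcal{X}_n,A\subset\mathcal{X}_n}\{H_{n,t}(x,A)-\pi_n(A)\}$. The family has a cutoff in the total variation if there are $t_n>0$ such that $d_n(at_n)\to0$ for all $a>1$ and $d_n(at_n)\to1$ for all $a\in(0,1)$. *)

theory Defs
  imports "HOL-Analysis.Analysis"
begin

text \<open>
  Matrices indexed by a countable set \<open>S\<close> are functions \<open>'a \<Rightarrow> 'a \<Rightarrow> real\<close>; only the entries with
  both indices in \<open>S\<close> are meaningful, and the carrier \<open>S\<close> is passed explicitly to every operation
  that sums over indices.
\<close>

type_synonym 'a matr = "'a \<Rightarrow> 'a \<Rightarrow> real"

definition mat_id :: "'a matr" where
  "mat_id x y = (if x = y then 1 else 0)"

definition mat_mul :: "'a set \<Rightarrow> 'a matr \<Rightarrow> 'a matr \<Rightarrow> 'a matr" where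
  "mat_mul S M N x y = (\<Sum>\<^sub>\<infinity>z\<in>S. M x z * N z y)"

primrec mat_pow :: "'a set \<Rightarrow> 'a matr \<Rightarrow> nat \<Rightarrow> 'a matr" where
  "mat_pow S M 0 = mat_id"
| "mat_pow S M (Suc k) = mat_mul S M (mat_pow S M k)"

definition mat_exp :: "'a set \<Rightarrow> 'a matr \<Rightarrow> 'a matr" where
  "mat_exp S M x y = (\<Sum>k. mat_pow S M k x y / fact k)"

record 'a chain =
  states :: "'a set"
  kernel :: "'a matr"
  stat :: "'a \<Rightarrow> real"

definition stochastic_matrix :: "'a set \<Rightarrow> 'a matr \<Rightarrow> bool" where
  "stochastic_matrix S K \<longleftrightarrow>
     (\<forall>x\<in>S. (\<forall>y\<in>S. 0 \<le> K x y) \<and> ((\<lambda>y. K x y) has_sum 1) S)"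

definition irreducible_matrix :: "'a set \<Rightarrow> 'a matr \<Rightarrow> bool" where
  "irreducible_matrix S K \<longleftrightarrow> (\<forall>x\<in>S. \<forall>y\<in>S. \<exists>k. mat_pow S K k x y > 0)"

definition stationary_distribution :: "'a set \<Rightarrow> 'a matr \<Rightarrow> ('a \<Rightarrow> real) \<Rightarrow> bool" where
  "stationary_distribution S K \<mu> \<longleftrightarrow>
     (\<forall>x\<in>S. 0 \<le> \<mu> x) \<and> (\<mu> has_sum 1) S \<and>
     (\<forall>y\<in>S. ((\<lambda>x. \<mu> x * K x y) has_sum \<mu> y) S)"

text \<open>The state space is automatically nonempty, since the stationary distribution has mass 1.\<close>

definition irreducible_markov_chain :: "'a chain \<Rightarrow> bool" where
  "irreducible_markov_chain C \<longleftrightarrow>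
     countable (states C) \<and>
     stochastic_matrix (states C) (kernel C) \<and>
     irreducible_matrix (states C) (kernel C) \<and>
     stationary_distribution (states C) (kernel C) (stat C)"

record 'a ct_chain =
  ct_states :: "'a set"
  ct_semigroup :: "real \<Rightarrow> 'a matr"
  ct_stat :: "'a \<Rightarrow> real"

definition continuous_time :: "'a chain \<Rightarrow> 'a ct_chain" where
  "continuous_time C =
     \<lparr> ct_states = states C,
       ct_semigroup = (\<lambda>t. mat_exp (states C) (\<lambda>x y. - t * (mat_id x y - kernel C x y))),
       ct_stat = stat C \<rparr>"

definition tv_distance :: "'a ct_chain \<Rightarrow> real \<Rightarrow> real" where
  "tv_distance C t =
     (SUP (x, A) \<in> ct_states C \<times> Pow (ct_states C).
        (\<Sum>\<^sub>\<infinity>y\<in>A. ct_semigroup C t x y) - (\<Sum>\<^sub>\<infinity>y\<in>A. ct_stat C y))"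

text \<open>Families are indexed by \<open>n \<ge> 1\<close>; the value of a family at \<open>0\<close> is irrelevant.\<close>

definition tv_cutoff :: "(nat \<Rightarrow> 'a ct_chain) \<Rightarrow> bool" where
  "tv_cutoff G \<longleftrightarrow>
     (\<exists>t :: nat \<Rightarrow> real. (\<forall>n\<ge>1. t n > 0) \<and>
        (\<forall>a>1. (\<lambda>n. tv_distance (G n) (a * t n)) \<longlonglongrightarrow> 0) \<and>
        (\<forall>a. 0 < a \<and> a < 1 \<longrightarrow> (\<lambda>n. tv_distance (G n) (a * t n)) \<longlonglongrightarrow> 1))"

definition ct_family :: "(nat \<Rightarrow> 'a chain) \<Rightarrow> nat \<Rightarrow> 'a ct_chain" where
  "ct_family F n = continuous_time (F n)"

text \<open>
  Points of the product of the state spaces \<open>1, \<dots>, n\<close> are extensional functions on \<open>{1..n}\<close>, and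
  \<open>mat_tensor n M\<close> is the tensor product of the matrices \<open>M 1, \<dots>, M n\<close>.
\<close>

definition mat_tensor :: "nat \<Rightarrow> (nat \<Rightarrow> 'a matr) \<Rightarrow> (nat \<Rightarrow> 'a) matr" where
  "mat_tensor n M x y = (\<Prod>j=1..n. M j (x j) (y j))"

definition product_family :: "(nat \<Rightarrow> 'a chain) \<Rightarrow> (nat \<Rightarrow> real) \<Rightarrow> nat \<Rightarrow> (nat \<Rightarrow> 'a) chain" where
  "product_family F p n =
     \<lparr> states = PiE {1..n} (\<lambda>j. states (F j)),
       kernel = (\<lambda>x y. \<Sum>i=1..n. p i / (\<Sum>j=1..n. p j) *
                   mat_tensor n (\<lambda>j. if j = i then kernel (F i) else mat_id) x y),
       stat = (\<lambda>x. \<Prod>j=1..n. stat (F j) (x j)) \<rparr>"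

end

theory Submission
  imports Defs "HOL-Real_Asymp.Real_Asymp"
begin

text \<open>
  Both examples are built from one ingredient, the two-state chain that at each step redraws its state
  from its stationary distribution. Its semigroup is \<open>H\<^sub>t = e\<^sup>-\<^sup>t I + (1 - e\<^sup>-\<^sup>t) \<Pi>\<close>, where every
  row of \<open>\<Pi>\<close> is the stationary distribution, so its distance to equilibrium decays like \<open>e\<^sup>-\<^sup>t\<close> and
  shows no abrupt transition (\<open>not_tv_cutoff_rare\<close>). The \<open>n\<close>-th chain gives mass \<open>2\<^sup>-\<^sup>n\<close> to one of
  its two states.

  Products of these chains with equal weights do have a cutoff, at time \<open>n ln (n + 1)\<close>, for the same
  reason as in the coupon collector problem. The semigroup of a product is the tensor product
  of the semigroups of the factors with rescaled times (\<open>heat_product\<close>). Once all coordinates have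
  been resampled the product is in equilibrium (\<open>separation_rare_product\<close>). As long as many
  coordinates have not been resampled, one of high index still sits in its rare state, which is
  nearly impossible in equilibrium (\<open>tv_rare_product_ge\<close>). This proves (a).

  For (b), take those product chains themselves as the family, with states renamed to natural
  numbers; it has a cutoff by (a). If the weights grow fast enough, then in the product of this
  family all factors but the first have already mixed when the first one, which is a single
  two-state chain, is still mixing gradually. The product therefore inherits the gradual
  decay of its first factor and has no cutoff (\<open>not_tv_cutoff_product_coded\<close>).

  Upper bounds go through the separation distance, for which products are immediate, and lower bounds
  through explicit events. All state spaces are finite, and semigroups are identified by the uniqueness
  of solutions to the forward equation (\<open>mat_exp_unique\<close>).
\<close>

section \<open>Exponentials of finite matrices\<close>

lemma mat_mul_finite:
  assumes "finite S"
  shows "mat_mul S M N x y = (\<Sum>z\<in>S. M x z * N z y)"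
  using assms by (simp add: mat_mul_def)

lemma mat_pow_abs_le:
  assumes S: "finite S" and "x \<in> S"
  shows "\<bar>mat_pow S M k x y\<bar> \<le> (\<Sum>u\<in>S. \<Sum>v\<in>S. \<bar>M u v\<bar>) ^ k"
  using \<open>x \<in> S\<close>
proof (induction k arbitrary: x)
  case 0
  then show ?case by (simp add: mat_id_def)
next
  case (Suc k)
  let ?B = "\<Sum>u\<in>S. \<Sum>v\<in>S. \<bar>M u v\<bar>"
  have "\<bar>mat_pow S M (Suc k) x y\<bar> \<le> (\<Sum>z\<in>S. \<bar>M x z\<bar> * \<bar>mat_pow S M k z y\<bar>)"
    using S by (simp add: mat_mul_finite sum_abs[THEN order_trans] abs_mult)
  also have "\<dots> \<le> (\<Sum>z\<in>S. \<bar>M x z\<bar> * ?B ^ k)"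
    by (intro sum_mono mult_left_mono Suc.IH) auto
  also have "\<dots> = (\<Sum>z\<in>S. \<bar>M x z\<bar>) * ?B ^ k"
    by (simp add: sum_distrib_right)
  also have "\<dots> \<le> ?B * ?B ^ k"
    using S Suc.prems
    by (intro mult_right_mono member_le_sum zero_le_power sum_nonneg) (auto intro: sum_nonneg)
  finally show ?case by simp
qed

lemma mat_pow_Suc_right:
  assumes S: "finite S" and "x \<in> S" "y \<in> S"
  shows "mat_pow S M (Suc k) x y = (\<Sum>z\<in>S. mat_pow S M k x z * M z y)"
  using \<open>x \<in> S\<close>
proof (induction k arbitrary: x)
  case 0
  with S \<open>y \<in> S\<close> show ?case
    by (simp add: mat_mul_finite mat_id_def if_distrib[of "\<lambda>c. _ * c"] if_distrib[of "\<lambda>c. c * _"]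
        cong: if_cong)
next
  case (Suc k)
  have "mat_pow S M (Suc (Suc k)) x y = (\<Sum>w\<in>S. M x w * (\<Sum>z\<in>S. mat_pow S M k w z * M z y))"
    using S Suc.IH by (simp add: mat_mul_finite)
  also have "\<dots> = (\<Sum>z\<in>S. (\<Sum>w\<in>S. M x w * mat_pow S M k w z) * M z y)"
    unfolding sum_distrib_left sum_distrib_right mult.assoc by (rule sum.swap)
  finally show ?case using S by (simp add: mat_mul_finite)
qed

lemma mat_pow_scale:
  assumes "finite S"
  shows "mat_pow S (\<lambda>x y. c * M x y) k x y = c ^ k * mat_pow S M k x y"
  using assms by (induction k arbitrary: x) (simp_all add: mat_mul_finite sum_distrib_left mult_ac)

lemma mat_exp_power_series:
  assumes "finite S"
  shows "mat_exp S (\<lambda>x y. s * M x y) x y = (\<Sum>k. (mat_pow S M k x y / fact k) * s ^ k)"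
  using assms by (simp add: mat_exp_def mat_pow_scale mult_ac)

lemma summable_mat_exp:
  assumes "finite S" "x \<in> S"
  shows "summable (\<lambda>k. (mat_pow S M k x y / fact k) * s ^ k)"
proof (rule summable_comparison_test')
  let ?B = "\<Sum>u\<in>S. \<Sum>v\<in>S. \<bar>M u v\<bar>"
  show "summable (\<lambda>k. inverse (fact k) * (?B * \<bar>s\<bar>) ^ k)"
    by (rule summable_exp)
  show "norm ((mat_pow S M k x y / fact k) * s ^ k) \<le> inverse (fact k) * (?B * \<bar>s\<bar>) ^ k" for k
    using mat_pow_abs_le[OF assms, of M k y]
    by (simp add: abs_mult power_abs power_mult_distrib divide_simps mult_right_mono)
qed

text \<open>
  Differentiating the exponential series termwise shifts the matrix powers by one; factoring
  that extra power out on the left or on the right gives the two forms of the derivative.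
\<close>

lemma mat_exp_has_derivative_aux:
  assumes "finite S" "x \<in> S"
  shows "((\<lambda>s. mat_exp S (\<lambda>x y. s * M x y) x y) has_real_derivative
           (\<Sum>k. (mat_pow S M (Suc k) x y / fact k) * s ^ k)) (at s)"
proof -
  let ?c = "\<lambda>k. mat_pow S M k x y / fact k"
  have "((\<lambda>s. \<Sum>k. ?c k * s ^ k) has_real_derivative (\<Sum>k. diffs ?c k * s ^ k)) (at s)"
    by (rule termdiffs_strong_converges_everywhere) (rule summable_mat_exp[OF assms])
  moreover have "diffs ?c k = mat_pow S M (Suc k) x y / fact k" for k
    by (simp add: diffs_def fact_Suc divide_simps del: mat_pow.simps of_nat_Suc)
  ultimately show ?thesis
    using assms by (simp add: mat_exp_power_series del: mat_pow.simps)
qed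

lemma mat_exp_has_derivative_left:
  assumes S: "finite S" "x \<in> S"
  shows "((\<lambda>s. mat_exp S (\<lambda>x y. s * M x y) x y) has_real_derivative
           (\<Sum>z\<in>S. M x z * mat_exp S (\<lambda>x y. s * M x y) z y)) (at s)"
proof -
  have "(\<Sum>k. (mat_pow S M (Suc k) x y / fact k) * s ^ k)
      = (\<Sum>k. \<Sum>z\<in>S. M x z * ((mat_pow S M k z y / fact k) * s ^ k))"
    using S by (simp add: mat_mul_finite sum_distrib_right sum_divide_distrib mult.assoc)
  also have "\<dots> = (\<Sum>z\<in>S. \<Sum>k. M x z * ((mat_pow S M k z y / fact k) * s ^ k))"
    using S by (intro suminf_sum summable_mult summable_mat_exp) auto
  also have "\<dots> = (\<Sum>z\<in>S. M x z * mat_exp S (\<lambda>x y. s * M x y) z y)"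
    unfolding mat_exp_power_series[OF S(1)]
    using S by (intro sum.cong refl suminf_mult summable_mat_exp) auto
  finally show ?thesis using mat_exp_has_derivative_aux[OF S, of M y s] by simp
qed

lemma mat_exp_has_derivative_right:
  assumes S: "finite S" "x \<in> S" "y \<in> S"
  shows "((\<lambda>s. mat_exp S (\<lambda>x y. s * M x y) x y) has_real_derivative
           (\<Sum>z\<in>S. mat_exp S (\<lambda>x y. s * M x y) x z * M z y)) (at s)"
proof -
  have "(\<Sum>k. (mat_pow S M (Suc k) x y / fact k) * s ^ k)
      = (\<Sum>k. \<Sum>z\<in>S. ((mat_pow S M k x z / fact k) * s ^ k) * M z y)"
    using S
    by (simp add: mat_pow_Suc_right sum_distrib_left sum_divide_distrib mult_ac del: mat_pow.simps)
  also have "\<dots> = (\<Sum>z\<in>S. \<Sum>k. ((mat_pow S M k x z / fact k) * s ^ k) * M z y)"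
    using S by (intro suminf_sum summable_mult2 summable_mat_exp) auto
  also have "\<dots> = (\<Sum>z\<in>S. mat_exp S (\<lambda>x y. s * M x y) x z * M z y)"
    unfolding mat_exp_power_series[OF S(1)]
    using S by (intro sum.cong refl suminf_mult2[symmetric] summable_mat_exp) auto
  finally show ?thesis using mat_exp_has_derivative_aux[OF S(1,2), of M y s] by simp
qed

lemma mat_exp_0:
  assumes "finite S"
  shows "mat_exp S (\<lambda>x y. 0) x y = mat_id x y"
  using mat_exp_power_series[OF assms, of 0 "\<lambda>x y. 0" x y]
    powser_zero[of "\<lambda>k. mat_pow S (\<lambda>x y. 0) k x y / fact k"]
  by simp

text \<open>
  The matrix exponential is the only solution of Kolmogorov's forward equation: for a solution
  \<open>G\<close> the product \<open>G(t - s) e\<^sup>s\<^sup>M\<close> has derivative \<open>0\<close> in \<open>s\<close>, and it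
  interpolates between \<open>G(t)\<close> and \<open>e\<^sup>t\<^sup>M\<close>. Every semigroup below is identified by checking this
  equation.
\<close>

lemma mat_exp_unique:
  assumes S: "finite S" and xy: "x \<in> S" "y \<in> S"
    and G0: "\<And>z. z \<in> S \<Longrightarrow> G 0 x z = mat_id x z"
    and G': "\<And>t z. z \<in> S \<Longrightarrow>
          ((\<lambda>t. G t x z) has_real_derivative (\<Sum>w\<in>S. G t x w * M w z)) (at t)"
  shows "mat_exp S (\<lambda>x y. t * M x y) x y = G t x y"
proof -
  let ?E = "\<lambda>s. mat_exp S (\<lambda>x y. s * M x y)"
  define \<phi> where "\<phi> s = (\<Sum>z\<in>S. G (t - s) x z * ?E s z y)" for s
  have "(\<phi> has_real_derivative 0) (at s)" for s
  proof -
    have Gs: "((\<lambda>s. G (t - s) x z) has_real_derivative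
              - (\<Sum>w\<in>S. G (t - s) x w * M w z)) (at s)" if "z \<in> S" for z
    proof -
      have "((\<lambda>s. G (t - s) x z) has_real_derivative
              (\<Sum>w\<in>S. G (t - s) x w * M w z) * (- 1)) (at s)"
        by (rule DERIV_chain2[OF G'[OF that]]) (auto intro!: derivative_eq_intros)
      then show ?thesis by simp
    qed
    have "(\<phi> has_real_derivative
        (\<Sum>z\<in>S. - (\<Sum>w\<in>S. G (t - s) x w * M w z) * ?E s z y
              + (\<Sum>w\<in>S. M z w * ?E s w y) * G (t - s) x z)) (at s)"
      unfolding \<phi>_def
      by (intro DERIV_sum DERIV_mult Gs mat_exp_has_derivative_left S)
    also have "(\<Sum>z\<in>S. - (\<Sum>w\<in>S. G (t - s) x w * M w z) * ?E s z y
              + (\<Sum>w\<in>S. M z w * ?E s w y) * G (t - s) x z)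
        = - (\<Sum>z\<in>S. \<Sum>w\<in>S. G (t - s) x w * M w z * ?E s z y)
          + (\<Sum>z\<in>S. \<Sum>w\<in>S. G (t - s) x z * M z w * ?E s w y)"
      by (simp add: sum.distrib sum_negf sum_distrib_left sum_distrib_right mult_ac sum_subtractf)
    also have "(\<Sum>z\<in>S. \<Sum>w\<in>S. G (t - s) x w * M w z * ?E s z y)
        = (\<Sum>w\<in>S. \<Sum>z\<in>S. G (t - s) x w * M w z * ?E s z y)"
      by (rule sum.swap)
    finally show ?thesis by simp
  qed
  then have "\<phi> t = \<phi> 0"
    by (intro DERIV_isconst_all) auto
  moreover have "\<phi> t = ?E t x y"
    using S xy G0
    by (simp add: \<phi>_def mat_id_def if_distrib[of "\<lambda>c. c * _"] cong: if_cong sum.cong)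
  moreover have "\<phi> 0 = G t x y"
    using S xy
    by (simp add: \<phi>_def mat_exp_0 mat_id_def if_distrib[of "\<lambda>c. _ * c"] cong: if_cong)
  ultimately show ?thesis by simp
qed

section \<open>Finite chains in continuous time\<close>

definition finite_chain :: "'a chain \<Rightarrow> bool" where
  "finite_chain C \<longleftrightarrow> finite (states C) \<and> irreducible_markov_chain C"

definition heat :: "'a chain \<Rightarrow> real \<Rightarrow> 'a matr" where
  "heat C t = mat_exp (states C) (\<lambda>x y. t * (kernel C x y - mat_id x y))"

lemma ct_semigroup_eq_heat: "ct_semigroup (continuous_time C) t = heat C t"
  by (simp add: continuous_time_def heat_def right_diff_distrib)

lemma finite_chain_iff:
  "finite_chain C \<longleftrightarrow> finite (states C) \<and>
     (\<forall>x\<in>states C. (\<forall>y\<in>states C. 0 \<le> kernel C x y) \<and> (\<Sum>y\<in>states C. kernel C x y) = 1) \<and>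
     irreducible_matrix (states C) (kernel C) \<and>
     (\<forall>x\<in>states C. 0 \<le> stat C x) \<and> (\<Sum>x\<in>states C. stat C x) = 1 \<and>
     (\<forall>y\<in>states C. (\<Sum>x\<in>states C. stat C x * kernel C x y) = stat C y)"
  (is "_ \<longleftrightarrow> ?R")
proof -
  have "(f has_sum c) (states C) \<longleftrightarrow> sum f (states C) = c" if "finite (states C)" for c :: real and f
    using has_sum_finite_iff[OF that] by auto
  then show ?thesis
    unfolding finite_chain_def irreducible_markov_chain_def stochastic_matrix_def
      stationary_distribution_def
    by (auto simp: countable_finite)
qed

lemma sum_mat_id [simp]:
  assumes "finite S" "y \<in> S"
  shows "(\<Sum>z\<in>S. f z * mat_id z y) = f y" "(\<Sum>z\<in>S. mat_id y z * f z) = f y"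
    "(\<Sum>z\<in>S. mat_id y z) = 1"
  using assms
  by (simp_all add: mat_id_def if_distrib[of "\<lambda>c. _ * c"] if_distrib[of "\<lambda>c. c * _"] cong: if_cong)

lemma heat_unique:
  assumes S: "finite (states C)" and xy: "x \<in> states C" "y \<in> states C"
    and G0: "\<And>z. z \<in> states C \<Longrightarrow> G 0 x z = mat_id x z"
    and G': "\<And>t z. z \<in> states C \<Longrightarrow> ((\<lambda>t. G t x z) has_real_derivative
               (\<Sum>w\<in>states C. G t x w * kernel C w z) - G t x z) (at t)"
  shows "heat C t x y = G t x y"
  unfolding heat_def
proof (rule mat_exp_unique[where G = G, OF S xy])
  show "G 0 x z = mat_id x z" if "z \<in> states C" for z
    using that by (rule G0)
  show "((\<lambda>t. G t x z) has_real_derivative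
          (\<Sum>w\<in>states C. G t x w * (kernel C w z - mat_id w z))) (at t)" if "z \<in> states C" for t z
    using G'[OF that, of t] S that by (simp add: right_diff_distrib sum_subtractf)
qed

lemma heat_0:
  assumes "finite (states C)"
  shows "heat C 0 x y = mat_id x y"
  using assms by (simp add: heat_def mat_exp_0)

lemma heat_has_derivative:
  assumes "finite (states C)" "x \<in> states C" "y \<in> states C"
  shows "((\<lambda>t. heat C t x y) has_real_derivative
           (\<Sum>z\<in>states C. heat C t x z * kernel C z y) - heat C t x y) (at t)"
  using mat_exp_has_derivative_right[OF assms, of "\<lambda>x y. kernel C x y - mat_id x y" t] assms
  by (simp add: heat_def right_diff_distrib sum_subtractf)

lemma heat_sum:
  assumes C: "finite_chain C" and x: "x \<in> states C"
  shows "(\<Sum>y\<in>states C. heat C t x y) = 1"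
proof -
  let ?S = "states C"
  have fin: "finite ?S" and K: "\<And>z. z \<in> ?S \<Longrightarrow> (\<Sum>y\<in>?S. kernel C z y) = 1"
    using C by (auto simp: finite_chain_iff)
  have "((\<lambda>t. \<Sum>y\<in>?S. heat C t x y) has_real_derivative 0) (at t)" for t
  proof -
    have "((\<lambda>t. \<Sum>y\<in>?S. heat C t x y) has_real_derivative
        (\<Sum>y\<in>?S. (\<Sum>z\<in>?S. heat C t x z * kernel C z y) - heat C t x y)) (at t)"
      using fin x by (intro DERIV_sum heat_has_derivative)
    also have "(\<Sum>y\<in>?S. (\<Sum>z\<in>?S. heat C t x z * kernel C z y) - heat C t x y)
        = (\<Sum>z\<in>?S. heat C t x z * (\<Sum>y\<in>?S. kernel C z y)) - (\<Sum>y\<in>?S. heat C t x y)"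
      unfolding sum_subtractf sum_distrib_left by (subst sum.swap) simp
    finally show ?thesis by (simp add: K)
  qed
  then have "(\<Sum>y\<in>?S. heat C t x y) = (\<Sum>y\<in>?S. heat C 0 x y)"
    by (intro DERIV_isconst_all[of "\<lambda>t. \<Sum>y\<in>?S. heat C t x y"]) auto
  then show ?thesis using fin x by (simp add: heat_0)
qed

text \<open>
  Splitting off the scalar factor \<open>e\<^sup>-\<^sup>t\<close> turns the semigroup into a Poisson average of the powers
  of the nonnegative matrix \<open>K\<close>.
\<close>

lemma heat_Poisson:
  assumes S: "finite (states C)" "x \<in> states C" "y \<in> states C"
  shows "heat C t x y = exp (- t) * (\<Sum>k. mat_pow (states C) (kernel C) k x y / fact k * t ^ k)"
proof -
  let ?S = "states C"
  let ?E = "\<lambda>t. mat_exp ?S (\<lambda>x y. t * kernel C x y)"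
  have "heat C t x y = exp (- t) * ?E t x y"
  proof (rule heat_unique[where G = "\<lambda>t x y. exp (- t) * ?E t x y", OF S])
    show "exp (- 0) * ?E 0 x z = mat_id x z" for z
      using S by (simp add: mat_exp_0)
    show "((\<lambda>t. exp (- t) * ?E t x z) has_real_derivative
        (\<Sum>w\<in>?S. exp (- t) * ?E t x w * kernel C w z) - exp (- t) * ?E t x z) (at t)"
      if "z \<in> ?S" for t z
      using S that
      by (auto intro!: derivative_eq_intros mat_exp_has_derivative_right
          simp: sum_distrib_left mult_ac)
  qed
  then show ?thesis using S by (simp add: mat_exp_power_series)
qed

lemma mat_pow_nonneg:
  assumes "finite S" "\<And>x y. x \<in> S \<Longrightarrow> y \<in> S \<Longrightarrow> 0 \<le> M x y" "x \<in> S" "y \<in> S"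
  shows "0 \<le> mat_pow S M k x y"
  using assms(3) by (induction k arbitrary: x)
    (use assms in \<open>auto simp: mat_id_def mat_mul_finite intro!: sum_nonneg\<close>)

lemma heat_nonneg:
  assumes "finite_chain C" "x \<in> states C" "y \<in> states C" "0 \<le> t"
  shows "0 \<le> heat C t x y"
proof -
  have "0 \<le> (\<Sum>k. mat_pow (states C) (kernel C) k x y / fact k * t ^ k)"
    using assms
    by (intro suminf_nonneg summable_mat_exp mult_nonneg_nonneg divide_nonneg_nonneg mat_pow_nonneg)
      (auto simp: finite_chain_iff)
  then show ?thesis
    using assms by (subst heat_Poisson) (auto simp: finite_chain_iff)
qed

text \<open>
  For a nonnegative kernel, irreducibility is the same as positivity of the semigroup at one
  (equivalently, every) positive time. In this form it is visibly inherited by products.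
\<close>

lemma heat_pos:
  assumes C: "finite_chain C" "x \<in> states C" "y \<in> states C" and t: "0 < t"
  shows "0 < heat C t x y"
proof -
  let ?P = "\<lambda>k. mat_pow (states C) (kernel C) k x y"
  have fin: "finite (states C)" using C by (auto simp: finite_chain_iff)
  have nn: "0 \<le> ?P k" for k
    using C by (intro mat_pow_nonneg) (auto simp: finite_chain_iff)
  obtain k where "0 < ?P k"
    using C unfolding finite_chain_iff irreducible_matrix_def by blast
  then have "0 < (\<Sum>k. ?P k / fact k * t ^ k)"
    using nn t by (intro suminf_pos2[where i = k] summable_mat_exp fin C) auto
  then show ?thesis using C fin by (simp add: heat_Poisson)
qed

lemma irreducible_if_heat_pos:
  assumes fin: "finite (states C)"
    and t: "0 \<le> t" and pos: "\<And>x y. x \<in> states C \<Longrightarrow> y \<in> states C \<Longrightarrow> 0 < heat C t x y"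
  shows "irreducible_matrix (states C) (kernel C)"
  unfolding irreducible_matrix_def
proof (intro ballI, rule ccontr)
  fix x y
  assume xy: "x \<in> states C" "y \<in> states C"
    and "\<not> (\<exists>k. 0 < mat_pow (states C) (kernel C) k x y)"
  then have "\<And>k. mat_pow (states C) (kernel C) k x y \<le> 0" by (simp add: not_less)
  then have "(\<Sum>k. mat_pow (states C) (kernel C) k x y / fact k * t ^ k) \<le> (\<Sum>k. 0)"
    using t by (intro suminf_le summable_mat_exp fin xy)
      (auto simp: divide_nonpos_pos mult_nonpos_nonneg)
  then have "heat C t x y \<le> 0"
    using fin xy by (simp add: heat_Poisson mult_nonneg_nonpos)
  with pos[OF xy] show False by simp
qed

section \<open>Bounds on the total variation distance\<close>

lemma tv_distance_finite:
  assumes "finite (states C)"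
  shows "tv_distance (continuous_time C) t =
    (SUP (x, A) \<in> states C \<times> Pow (states C). (\<Sum>y\<in>A. heat C t x y) - (\<Sum>y\<in>A. stat C y))"
  unfolding tv_distance_def ct_semigroup_eq_heat
  using assms by (auto simp: continuous_time_def finite_subset intro!: SUP_cong)

lemma tv_distance_ge:
  assumes C: "finite_chain C" and t: "0 \<le> t" and xA: "x \<in> states C" "A \<subseteq> states C"
  shows "(\<Sum>y\<in>A. heat C t x y) - (\<Sum>y\<in>A. stat C y) \<le> tv_distance (continuous_time C) t"
proof -
  have fin: "finite (states C)" using C by (simp add: finite_chain_iff)
  have "(\<Sum>y\<in>B. heat C t z y) - (\<Sum>y\<in>B. stat C y) \<le> 1" if "z \<in> states C" "B \<subseteq> states C" for z B
  proof -
    have "(\<Sum>y\<in>B. heat C t z y) \<le> (\<Sum>y\<in>states C. heat C t z y)"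
      using that fin t C by (intro sum_mono2 heat_nonneg) auto
    moreover have "0 \<le> (\<Sum>y\<in>B. stat C y)"
      using that C by (intro sum_nonneg) (auto simp: finite_chain_iff)
    ultimately show ?thesis using heat_sum[OF C that(1), of t] by simp
  qed
  then have "bdd_above ((\<lambda>(x, A). (\<Sum>y\<in>A. heat C t x y) - (\<Sum>y\<in>A. stat C y))
      ` (states C \<times> Pow (states C)))"
    by (intro bdd_aboveI[where M = 1]) auto
  from cSUP_upper[OF _ this, of "(x, A)"] show ?thesis
    using xA fin by (simp add: tv_distance_finite)
qed

lemma finite_chain_states_nonempty:
  assumes "finite_chain C"
  shows "states C \<noteq> {}"
  using assms by (auto simp: finite_chain_iff)

text \<open>
  One-sided pointwise comparison of \<open>H\<^sub>t\<close> with the stationary distribution, the separation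
  distance. Unlike bounds on total variation, such bounds can be multiplied over the factors of a product.
\<close>

definition separation_le :: "'a chain \<Rightarrow> real \<Rightarrow> real \<Rightarrow> bool" where
  "separation_le C t \<delta> \<longleftrightarrow> (\<forall>x\<in>states C. \<forall>y\<in>states C. (1 - \<delta>) * stat C y \<le> heat C t x y)"

lemma separation_le_mono:
  assumes "finite_chain C" "separation_le C t \<delta>" "\<delta> \<le> \<epsilon>"
  shows "separation_le C t \<epsilon>"
  unfolding separation_le_def
proof (intro ballI)
  fix x y assume xy: "x \<in> states C" "y \<in> states C"
  have "(1 - \<epsilon>) * stat C y \<le> (1 - \<delta>) * stat C y"
    using assms xy by (intro mult_right_mono) (auto simp: finite_chain_iff)
  also have "\<dots> \<le> heat C t x y" using assms xy by (simp add: separation_le_def)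
  finally show "(1 - \<epsilon>) * stat C y \<le> heat C t x y" .
qed

lemma tv_distance_le_separation:
  assumes C: "finite_chain C" and sep: "separation_le C t \<delta>" and \<delta>: "0 \<le> \<delta>"
  shows "tv_distance (continuous_time C) t \<le> \<delta>"
proof -
  let ?S = "states C"
  have fin: "finite ?S" using C by (simp add: finite_chain_iff)
  have "(\<Sum>y\<in>A. heat C t x y) - (\<Sum>y\<in>A. stat C y) \<le> \<delta>" if x: "x \<in> ?S" and A: "A \<subseteq> ?S" for x A
  proof -
    have pi: "(\<Sum>y\<in>?S - A. stat C y) \<le> 1" "(\<Sum>y\<in>A. stat C y) = 1 - (\<Sum>y\<in>?S - A. stat C y)"
      using C A fin sum_diff[OF fin A, of "stat C"] sum_nonneg[of A "stat C"]
      by (auto simp: finite_chain_iff)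
    \<comment> \<open>Pass to the complement, where the pointwise lower bound points in the right direction.\<close>
    have "(\<Sum>y\<in>A. heat C t x y) - (\<Sum>y\<in>A. stat C y)
        = (\<Sum>y\<in>?S - A. stat C y) - (\<Sum>y\<in>?S - A. heat C t x y)"
      using sum_diff[OF fin A, of "heat C t x"] heat_sum[OF C x, of t] pi by simp
    also have "\<dots> \<le> (\<Sum>y\<in>?S - A. stat C y) - (\<Sum>y\<in>?S - A. (1 - \<delta>) * stat C y)"
      using sep x by (intro diff_left_mono sum_mono) (auto simp: separation_le_def)
    also have "\<dots> = \<delta> * (\<Sum>y\<in>?S - A. stat C y)"
      by (simp add: left_diff_distrib sum_subtractf sum_distrib_left)
    also have "\<dots> \<le> \<delta> * 1" using \<delta> pi by (intro mult_left_mono)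
    finally show ?thesis by simp
  qed
  then show ?thesis
    unfolding tv_distance_finite[OF fin]
    using finite_chain_states_nonempty[OF C] by (intro cSUP_least) auto
qed

section \<open>Products\<close>

lemma sum_PiE_prod:
  fixes f :: "'i \<Rightarrow> 'a \<Rightarrow> real"
  assumes "finite I" "\<And>i. i \<in> I \<Longrightarrow> finite (S i)"
  shows "(\<Sum>x\<in>PiE I S. \<Prod>i\<in>I. f i (x i)) = (\<Prod>i\<in>I. \<Sum>y\<in>S i. f i y)"
  using assms by (simp add: prod_sum_PiE)

lemma mat_id_PiE:
  fixes n :: nat
  assumes "x \<in> PiE {1..n} S" "y \<in> PiE {1..n} S"
  shows "mat_id x y = (\<Prod>j=1..n. mat_id (x j) (y j))"
proof (cases "x = y")
  case False
  then obtain j where "j \<in> {1..n}" "x j \<noteq> y j" using assms by (metis PiE_ext)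
  then have "(\<Prod>j=1..n. mat_id (x j) (y j)) = 0"
    by (intro prod_zero) (auto simp: mat_id_def)
  then show ?thesis using False by (simp add: mat_id_def)
qed (simp add: mat_id_def)

text \<open>
  A step of coordinate \<open>i\<close> acts on a product-form row vector by changing its \<open>i\<close>-th factor only. This
  computation serves both the forward equation and stationarity.
\<close>

lemma sum_PiE_coordinate_kernel:
  assumes fin: "\<And>j. j \<in> {1..n} \<Longrightarrow> finite (S j)" and i: "i \<in> {1..n}"
    and y: "y \<in> PiE {1..n} S"
  shows "(\<Sum>w\<in>PiE {1..n} S. (\<Prod>j=1..n. g j (w j)) *
            mat_tensor n (\<lambda>j. if j = i then K else mat_id) w y)
       = (\<Sum>z\<in>S i. g i z * K z (y i)) * (\<Prod>j\<in>{1..n} - {i}. g j (y j))"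
proof -
  have "(\<Sum>w\<in>PiE {1..n} S. (\<Prod>j=1..n. g j (w j)) *
            mat_tensor n (\<lambda>j. if j = i then K else mat_id) w y)
      = (\<Prod>j=1..n. \<Sum>z\<in>S j. g j z * (if j = i then K else mat_id) z (y j))"
    using fin by (subst sum_PiE_prod[symmetric]) (auto simp: mat_tensor_def prod.distrib)
  also have "\<dots> = (\<Sum>z\<in>S i. g i z * K z (y i)) *
      (\<Prod>j\<in>{1..n} - {i}. \<Sum>z\<in>S j. g j z * (if j = i then K else mat_id) z (y j))"
    using i by (subst prod.remove[of _ i]) auto
  also have "(\<Prod>j\<in>{1..n} - {i}. \<Sum>z\<in>S j. g j z * (if j = i then K else mat_id) z (y j))
      = (\<Prod>j\<in>{1..n} - {i}. g j (y j))"
    using fin y by (intro prod.cong refl) (auto simp: PiE_iff)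
  finally show ?thesis .
qed

text \<open>
  In the product chain the coordinates evolve independently, the \<open>j\<close>-th one slowed down by the
  factor \<open>p\<^sub>j/q\<^sub>n\<close>: by the product rule, the tensor product on the right-hand side solves the forward equation.
\<close>

lemma heat_product:
  assumes fin: "\<And>j. j \<in> {1..n} \<Longrightarrow> finite (states (F j))"
    and q: "(\<Sum>j=1..n. p j) \<noteq> 0"
    and xy: "x \<in> states (product_family F p n)" "y \<in> states (product_family F p n)"
  shows "heat (product_family F p n) t x y
       = (\<Prod>j=1..n. heat (F j) (p j / (\<Sum>j=1..n. p j) * t) (x j) (y j))"
proof (rule heat_unique[where
      G = "\<lambda>t x y. \<Prod>j=1..n. heat (F j) (p j / (\<Sum>j=1..n. p j) * t) (x j) (y j)", OF _ xy])
  let ?q = "\<Sum>j=1..n. p j"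
  let ?r = "\<lambda>j. p j / ?q"
  let ?S = "PiE {1..n} (\<lambda>j. states (F j))"
  have S: "states (product_family F p n) = ?S" by (simp add: product_family_def)
  show "finite (states (product_family F p n))"
    using fin by (auto simp: S intro!: finite_PiE)
  have x: "x \<in> ?S" using xy S by simp
  show "(\<Prod>j=1..n. heat (F j) (?r j * 0) (x j) (z j)) = mat_id x z"
    if "z \<in> states (product_family F p n)" for z
    using mat_id_PiE[of x n _ z] that x S fin by (simp add: heat_0)
  fix t z assume "z \<in> states (product_family F p n)"
  then have z: "z \<in> ?S" using S by simp
  let ?H = "\<lambda>j w. heat (F j) (?r j * t) (x j) w"
  let ?HK = "\<lambda>i. \<Sum>w\<in>states (F i). ?H i w * kernel (F i) w (z i)"
  let ?rest = "\<lambda>i. \<Prod>j\<in>{1..n} - {i}. ?H j (z j)"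
  have r: "(\<Sum>i=1..n. ?r i) = 1" using q by (simp add: sum_divide_distrib[symmetric])
  have "((\<lambda>t. \<Prod>j=1..n. heat (F j) (?r j * t) (x j) (z j)) has_real_derivative
      (\<Sum>i=1..n. ((?HK i - ?H i (z i)) * ?r i) * ?rest i)) (at t)"
  proof (rule has_field_derivative_prod)
    fix i assume i: "i \<in> {1..n}"
    show "((\<lambda>t. heat (F i) (?r i * t) (x i) (z i)) has_real_derivative
        (?HK i - ?H i (z i)) * ?r i) (at t)"
    proof (rule DERIV_chain2[OF heat_has_derivative])
      show "((\<lambda>t. ?r i * t) has_real_derivative ?r i) (at t)"
        by (rule DERIV_cmult_Id)
    qed (use fin i x z in \<open>auto simp: PiE_iff\<close>)
  qed
  also have "(\<Sum>i=1..n. ((?HK i - ?H i (z i)) * ?r i) * ?rest i)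
      = (\<Sum>i=1..n. ?r i * (?HK i * ?rest i)) - (\<Sum>i=1..n. ?r i * (?H i (z i) * ?rest i))"
    by (simp add: algebra_simps sum_subtractf)
  also have "(\<Sum>i=1..n. ?r i * (?H i (z i) * ?rest i)) = (\<Sum>i=1..n. ?r i * (\<Prod>j=1..n. ?H j (z j)))"
    by (intro sum.cong refl arg_cong2[where f = "(*)"] prod.remove[symmetric]) auto
  also have "\<dots> = (\<Prod>j=1..n. ?H j (z j))" by (simp only: sum_distrib_right[symmetric] r mult_1)
  also have "(\<Sum>i=1..n. ?r i * (?HK i * ?rest i))
      = (\<Sum>i=1..n. ?r i * (\<Sum>w\<in>?S. (\<Prod>j=1..n. ?H j (w j)) *
            mat_tensor n (\<lambda>j. if j = i then kernel (F i) else mat_id) w z))"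
    using fin z by (intro sum.cong refl arg_cong2[where f = "(*)"] sum_PiE_coordinate_kernel[symmetric])
  also have "\<dots> = (\<Sum>w\<in>?S. (\<Prod>j=1..n. ?H j (w j)) * kernel (product_family F p n) w z)"
    unfolding sum_distrib_left product_family_def chain.simps
    by (subst sum.swap) (simp add: mult_ac)
  finally show "((\<lambda>t. \<Prod>j=1..n. heat (F j) (?r j * t) (x j) (z j)) has_real_derivative
      (\<Sum>w\<in>states (product_family F p n). (\<Prod>j=1..n. ?H j (w j)) * kernel (product_family F p n) w z)
      - (\<Prod>j=1..n. ?H j (z j))) (at t)"
    by (simp only: S)
qed

lemma states_product [simp]: "states (product_family F p n) = PiE {1..n} (\<lambda>j. states (F j))"
  by (simp add: product_family_def)

lemma stat_product [simp]: "stat (product_family F p n) x = (\<Prod>j=1..n. stat (F j) (x j))"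
  by (simp add: product_family_def)

text \<open>
  Irreducibility is read off from the semigroup: its entries at time \<open>1\<close> are products of entries of
  the factors at positive times.
\<close>

lemma finite_chain_product:
  assumes C: "\<And>j. j \<in> {1..n} \<Longrightarrow> finite_chain (F j)"
    and p: "\<And>j. j \<in> {1..n} \<Longrightarrow> 0 < p j" and n: "1 \<le> n"
  shows "finite_chain (product_family F p n)"
proof -
  let ?P = "product_family F p n" and ?S = "PiE {1..n} (\<lambda>j. states (F j))"
  let ?q = "\<Sum>j=1..n. p j"
  let ?T = "\<lambda>i. mat_tensor n (\<lambda>j. if j = i then kernel (F i) else mat_id)"
  have fin: "\<And>j. j \<in> {1..n} \<Longrightarrow> finite (states (F j))"
    using C by (simp add: finite_chain_iff)
  have finS: "finite ?S" using fin by (intro finite_PiE) auto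
  have q: "0 < ?q" using p n by (intro sum_pos) auto
  have r: "(\<Sum>i=1..n. p i / ?q) = 1" using q by (simp add: sum_divide_distrib[symmetric])
  have K: "kernel ?P x y = (\<Sum>i=1..n. p i / ?q * ?T i x y)" for x y
    by (simp add: product_family_def)
  have nonneg: "0 \<le> kernel ?P x y" if "x \<in> ?S" "y \<in> ?S" for x y
    unfolding K mat_tensor_def
    using that C p q
    by (intro sum_nonneg mult_nonneg_nonneg divide_nonneg_nonneg prod_nonneg)
      (auto simp: mat_id_def finite_chain_iff PiE_iff less_imp_le)
  have row: "(\<Sum>y\<in>?S. kernel ?P x y) = 1" if x: "x \<in> ?S" for x
  proof -
    have T: "(\<Sum>y\<in>?S. ?T i x y) = 1" if "i \<in> {1..n}" for i
    proof -
      have "(\<Sum>y\<in>?S. ?T i x y)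
          = (\<Prod>j=1..n. \<Sum>z\<in>states (F j). (if j = i then kernel (F i) else mat_id) (x j) z)"
        unfolding mat_tensor_def by (rule sum_PiE_prod) (use fin in auto)
      also have "\<dots> = 1"
        using C fin x by (intro prod.neutral) (auto simp: finite_chain_iff PiE_iff)
      finally show ?thesis .
    qed
    have "(\<Sum>y\<in>?S. kernel ?P x y) = (\<Sum>i=1..n. p i / ?q * (\<Sum>y\<in>?S. ?T i x y))"
      unfolding K sum_distrib_left by (rule sum.swap)
    also have "\<dots> = (\<Sum>i=1..n. p i / ?q)"
      by (intro sum.cong refl) (simp only: T mult_1_right)
    finally show ?thesis using r by simp
  qed
  have stationary: "(\<Sum>x\<in>?S. stat ?P x * kernel ?P x y) = stat ?P y" if y: "y \<in> ?S" for y
  proof -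
    have T: "(\<Sum>x\<in>?S. stat ?P x * ?T i x y) = stat ?P y" if i: "i \<in> {1..n}" for i
    proof -
      have "(\<Sum>x\<in>?S. stat ?P x * ?T i x y)
          = (\<Sum>z\<in>states (F i). stat (F i) z * kernel (F i) z (y i)) *
            (\<Prod>j\<in>{1..n} - {i}. stat (F j) (y j))"
        unfolding stat_product
        by (rule sum_PiE_coordinate_kernel[where g = "\<lambda>j. stat (F j)"]) (use fin i y in auto)
      also have "\<dots> = stat ?P y"
        using C i y by (subst stat_product, subst prod.remove[of _ i])
          (auto simp: finite_chain_iff PiE_iff)
      finally show ?thesis .
    qed
    have "(\<Sum>x\<in>?S. stat ?P x * kernel ?P x y)
        = (\<Sum>i=1..n. p i / ?q * (\<Sum>x\<in>?S. stat ?P x * ?T i x y))"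
      unfolding K sum_distrib_left by (subst sum.swap) (simp add: mult_ac)
    also have "\<dots> = (\<Sum>i=1..n. p i / ?q) * stat ?P y"
      unfolding sum_distrib_right by (intro sum.cong refl) (simp only: T)
    finally show ?thesis using r by simp
  qed
  have irr: "irreducible_matrix (states ?P) (kernel ?P)"
  proof (rule irreducible_if_heat_pos[of _ 1])
    show "0 < heat ?P 1 x y" if "x \<in> states ?P" "y \<in> states ?P" for x y
      using heat_product[of n F p x y 1] fin q that
      by (auto intro!: prod_pos heat_pos C divide_pos_pos p simp: PiE_iff)
  qed (use finS in auto)
  have "(\<Sum>x\<in>?S. stat ?P x) = 1"
    using sum_PiE_prod[of "{1..n}" "\<lambda>j. states (F j)" "\<lambda>j. stat (F j)"] fin C
    by (simp add: finite_chain_iff)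
  moreover have "0 \<le> stat ?P x" if "x \<in> ?S" for x
    using C that by (auto intro!: prod_nonneg simp: finite_chain_iff PiE_iff)
  ultimately show ?thesis
    using finS nonneg row stationary irr by (simp add: finite_chain_iff del: stat_product)
qed

lemma heat_product_box:
  assumes fin: "\<And>j. j \<in> {1..n} \<Longrightarrow> finite (states (F j))"
    and q: "(\<Sum>j=1..n. p j) \<noteq> 0"
    and x: "x \<in> states (product_family F p n)"
    and B: "\<And>j. j \<in> {1..n} \<Longrightarrow> B j \<subseteq> states (F j)"
  shows "(\<Sum>y\<in>PiE {1..n} B. heat (product_family F p n) t x y)
       = (\<Prod>j=1..n. \<Sum>z\<in>B j. heat (F j) (p j / (\<Sum>j=1..n. p j) * t) (x j) z)"
proof -
  have "PiE {1..n} B \<subseteq> states (product_family F p n)"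
    using B by (fastforce simp: PiE_iff)
  then have "(\<Sum>y\<in>PiE {1..n} B. heat (product_family F p n) t x y)
      = (\<Sum>y\<in>PiE {1..n} B. \<Prod>j=1..n. heat (F j) (p j / (\<Sum>j=1..n. p j) * t) (x j) (y j))"
    using heat_product[of n F p x _ t] fin q x by (intro sum.cong refl) blast
  also have "\<dots> = (\<Prod>j=1..n. \<Sum>z\<in>B j. heat (F j) (p j / (\<Sum>j=1..n. p j) * t) (x j) z)"
    using fin B by (intro sum_PiE_prod) (auto intro: finite_subset)
  finally show ?thesis .
qed

lemma stat_product_box:
  assumes "\<And>j. j \<in> {1..n} \<Longrightarrow> finite (B j)"
  shows "(\<Sum>y\<in>PiE {1..n} B. stat (product_family F p n) y) = (\<Prod>j=1..n. \<Sum>z\<in>B j. stat (F j) z)"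
  unfolding stat_product using assms by (intro sum_PiE_prod) auto

text \<open>Cylinder events transfer any discrepancy of one coordinate to the product.\<close>

lemma tv_product_ge_factor:
  assumes C: "\<And>j. j \<in> {1..n} \<Longrightarrow> finite_chain (F j)"
    and p: "\<And>j. j \<in> {1..n} \<Longrightarrow> 0 < p j" and i: "i \<in> {1..n}" and t: "0 \<le> t"
  shows "tv_distance (continuous_time (F i)) (p i / (\<Sum>j=1..n. p j) * t)
       \<le> tv_distance (continuous_time (product_family F p n)) t"
proof -
  let ?P = "product_family F p n"
  let ?s = "\<lambda>j. p j / (\<Sum>j=1..n. p j) * t"
  have fin: "\<And>j. j \<in> {1..n} \<Longrightarrow> finite (states (F j))"
    using C by (simp add: finite_chain_iff)
  have q: "(\<Sum>j=1..n. p j) \<noteq> 0" using sum_pos[of "{1..n}" p] p i by force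
  have "(\<Sum>z\<in>A. heat (F i) (?s i) a z) - (\<Sum>z\<in>A. stat (F i) z) \<le> tv_distance (continuous_time ?P) t"
    if a: "a \<in> states (F i)" and A: "A \<subseteq> states (F i)" for a A
  proof -
    define x where "x = (\<lambda>j\<in>{1..n}. if j = i then a else (SOME z. z \<in> states (F j)))"
    define B where "B j = (if j = i then A else states (F j))" for j
    have x: "x \<in> states ?P"
      using a finite_chain_states_nonempty[OF C] by (auto simp: x_def some_in_eq)
    have BS: "B j \<subseteq> states (F j)" for j using A by (simp add: B_def)
    have finB: "finite (B j)" if "j \<in> {1..n}" for j
      using fin[OF that] BS finite_subset by blast
    have "(\<Sum>y\<in>PiE {1..n} B. heat ?P t x y) = (\<Prod>j=1..n. \<Sum>z\<in>B j. heat (F j) (?s j) (x j) z)"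
      by (rule heat_product_box[OF fin q x BS])
    also have "\<dots> = (\<Sum>z\<in>A. heat (F i) (?s i) a z) *
        (\<Prod>j\<in>{1..n} - {i}. \<Sum>z\<in>B j. heat (F j) (?s j) (x j) z)"
      using i by (subst prod.remove[of _ i]) (auto simp: B_def x_def)
    also have "(\<Prod>j\<in>{1..n} - {i}. \<Sum>z\<in>B j. heat (F j) (?s j) (x j) z) = 1"
      using x by (intro prod.neutral) (auto simp: B_def PiE_iff intro!: heat_sum C)
    finally have H: "(\<Sum>y\<in>PiE {1..n} B. heat ?P t x y) = (\<Sum>z\<in>A. heat (F i) (?s i) a z)" by simp
    have "(\<Sum>y\<in>PiE {1..n} B. stat ?P y) = (\<Prod>j=1..n. \<Sum>z\<in>B j. stat (F j) z)"
      by (rule stat_product_box[OF finB])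
    also have "\<dots> = (\<Sum>z\<in>A. stat (F i) z) * (\<Prod>j\<in>{1..n} - {i}. \<Sum>z\<in>B j. stat (F j) z)"
      using i by (subst prod.remove[of _ i]) (auto simp: B_def)
    also have "(\<Prod>j\<in>{1..n} - {i}. \<Sum>z\<in>B j. stat (F j) z) = 1"
      using C by (intro prod.neutral) (auto simp: B_def finite_chain_iff)
    finally have \<pi>: "(\<Sum>y\<in>PiE {1..n} B. stat ?P y) = (\<Sum>z\<in>A. stat (F i) z)" by simp
    have "PiE {1..n} B \<subseteq> states ?P" using BS by (simp add: PiE_mono)
    from tv_distance_ge[OF finite_chain_product[OF C p] t x this] H \<pi> i show ?thesis by simp
  qed
  then show ?thesis
    using i fin finite_chain_states_nonempty[OF C[OF i]]
    by (subst tv_distance_finite) (auto intro!: cSUP_least)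
qed

lemma one_minus_sum_le_prod:
  fixes a :: "'i \<Rightarrow> real"
  assumes "finite I" "\<And>i. i \<in> I \<Longrightarrow> 0 \<le> a i \<and> a i \<le> 1"
  shows "1 - (\<Sum>i\<in>I. a i) \<le> (\<Prod>i\<in>I. 1 - a i)"
  using assms
proof (induction I rule: finite_induct)
  case (insert i I)
  have "1 - (a i + sum a I) \<le> 1 - sum a I - a i * (\<Prod>i\<in>I. 1 - a i)"
    using insert.prems by (auto intro!: mult_left_le prod_le_1)
  also have "\<dots> \<le> (\<Prod>i\<in>I. 1 - a i) - a i * (\<Prod>i\<in>I. 1 - a i)"
    using insert by simp
  finally show ?case using insert.hyps by (simp add: algebra_simps)
qed simp

text \<open>
  Separations of the factors combine to \<open>1 - \<Prod>\<^sub>j (1 - \<delta>\<^sub>j)\<close>, which the union bound estimates by the sum.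
\<close>

lemma separation_product:
  assumes C: "\<And>j. j \<in> {1..n} \<Longrightarrow> finite_chain (F j)"
    and p: "\<And>j. j \<in> {1..n} \<Longrightarrow> 0 < p j" and n: "1 \<le> n"
    and sep: "\<And>j. j \<in> {1..n} \<Longrightarrow> separation_le (F j) (p j / (\<Sum>j=1..n. p j) * t) (\<delta> j)"
    and \<delta>: "\<And>j. j \<in> {1..n} \<Longrightarrow> 0 \<le> \<delta> j \<and> \<delta> j \<le> 1"
  shows "separation_le (product_family F p n) t (\<Sum>j=1..n. \<delta> j)"
  unfolding separation_le_def
proof (intro ballI)
  let ?P = "product_family F p n"
  fix x y assume xy: "x \<in> states ?P" "y \<in> states ?P"
  have q: "(\<Sum>j=1..n. p j) \<noteq> 0" using sum_pos[of "{1..n}" p] p n by force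
  have "(1 - (\<Sum>j=1..n. \<delta> j)) * stat ?P y \<le> (\<Prod>j=1..n. 1 - \<delta> j) * (\<Prod>j=1..n. stat (F j) (y j))"
    unfolding stat_product using \<delta> C xy
    by (intro mult_right_mono one_minus_sum_le_prod prod_nonneg) (auto simp: finite_chain_iff PiE_iff)
  also have "\<dots> \<le> (\<Prod>j=1..n. heat (F j) (p j / (\<Sum>j=1..n. p j) * t) (x j) (y j))"
    unfolding prod.distrib[symmetric] using \<delta> C xy sep
    by (intro prod_mono conjI mult_nonneg_nonneg) (auto simp: finite_chain_iff PiE_iff separation_le_def)
  also have "\<dots> = heat ?P t x y"
    using C q xy by (intro heat_product[symmetric]) (auto simp: finite_chain_iff)
  finally show "(1 - (\<Sum>j=1..n. \<delta> j)) * stat ?P y \<le> heat ?P t x y" .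
qed

section \<open>Renaming states\<close>

text \<open>
  The states of a product chain are functions. Renaming them injectively turns such a chain into one
  on the natural numbers, so that product chains can serve as factors of another product.
\<close>

definition relabel :: "('a \<Rightarrow> 'b) \<Rightarrow> 'a chain \<Rightarrow> 'b chain" where
  "relabel f C =
     \<lparr> states = f ` states C,
       kernel = (\<lambda>x y. kernel C (inv_into (states C) f x) (inv_into (states C) f y)),
       stat = (\<lambda>x. stat C (inv_into (states C) f x)) \<rparr>"

lemma states_relabel [simp]: "states (relabel f C) = f ` states C"
  by (simp add: relabel_def)

lemma stat_relabel:
  assumes "inj_on f (states C)" "x \<in> states C"
  shows "stat (relabel f C) (f x) = stat C x"
  using assms by (simp add: relabel_def)

lemma mat_pow_relabel:
  assumes f: "inj_on f S" and xy: "x \<in> S" "y \<in> S"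
    and M: "\<And>x y. x \<in> S \<Longrightarrow> y \<in> S \<Longrightarrow> N (f x) (f y) = M x y"
  shows "mat_pow (f ` S) N k (f x) (f y) = mat_pow S M k x y"
  using xy(1)
proof (induction k arbitrary: x)
  case 0
  then show ?case using f xy by (simp add: mat_id_def inj_on_eq_iff)
next
  case (Suc k)
  then show ?case
    by (simp add: mat_mul_def infsum_reindex[OF f] o_def M cong: infsum_cong)
qed

lemma heat_relabel:
  assumes f: "inj_on f (states C)" and xy: "x \<in> states C" "y \<in> states C"
  shows "heat (relabel f C) t (f x) (f y) = heat C t x y"
  unfolding heat_def mat_exp_def
proof (intro suminf_cong arg_cong2[where f = "(/)"] refl)
  fix k
  show "mat_pow (states (relabel f C)) (\<lambda>x y. t * (kernel (relabel f C) x y - mat_id x y)) k (f x) (f y)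
      = mat_pow (states C) (\<lambda>x y. t * (kernel C x y - mat_id x y)) k x y"
    unfolding states_relabel using f xy
    by (intro mat_pow_relabel) (auto simp: relabel_def mat_id_def inj_on_eq_iff)
qed

lemma tv_distance_relabel:
  assumes f: "inj_on f (states C)"
  shows "tv_distance (continuous_time (relabel f C)) t = tv_distance (continuous_time C) t"
proof -
  let ?S = "states C"
  let ?D = "\<lambda>C (x, A). (\<Sum>\<^sub>\<infinity>y\<in>A. heat C t x y) - (\<Sum>\<^sub>\<infinity>y\<in>A. stat C y)"
  have D: "?D (relabel f C) (f x, f ` A) = ?D C (x, A)" if "x \<in> ?S" "A \<subseteq> ?S" for x A
  proof -
    have fA: "inj_on f A" using f that inj_on_subset by blast
    have "(\<Sum>\<^sub>\<infinity>y\<in>A. heat (relabel f C) t (f x) (f y)) = (\<Sum>\<^sub>\<infinity>y\<in>A. heat C t x y)"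
      using that f by (intro infsum_cong heat_relabel) auto
    moreover have "(\<Sum>\<^sub>\<infinity>y\<in>A. stat (relabel f C) (f y)) = (\<Sum>\<^sub>\<infinity>y\<in>A. stat C y)"
      using that f by (intro infsum_cong) (auto simp: relabel_def)
    ultimately show ?thesis by (simp add: infsum_reindex[OF fA] o_def)
  qed
  have "f ` ?S \<times> Pow (f ` ?S) = (\<lambda>(x, A). (f x, f ` A)) ` (?S \<times> Pow ?S)"
    by (auto simp: image_iff subset_image_iff) blast+
  then have "?D (relabel f C) ` (f ` ?S \<times> Pow (f ` ?S)) = ?D C ` (?S \<times> Pow ?S)"
    using D by (simp only: image_image) (intro image_cong; auto)
  then show ?thesis
    unfolding tv_distance_def ct_semigroup_eq_heat
    by (simp add: continuous_time_def relabel_def)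
qed

lemma finite_chain_relabel:
  assumes f: "inj_on f (states C)" and C: "finite_chain C"
  shows "finite_chain (relabel f C)"
proof -
  have "irreducible_matrix (f ` states C) (kernel (relabel f C))"
    unfolding irreducible_matrix_def
  proof (clarify)
    fix x y assume xy: "x \<in> states C" "y \<in> states C"
    then obtain k where "0 < mat_pow (states C) (kernel C) k x y"
      using C unfolding finite_chain_iff irreducible_matrix_def by blast
    then show "\<exists>k. 0 < mat_pow (f ` states C) (kernel (relabel f C)) k (f x) (f y)"
      using f xy mat_pow_relabel[of f "states C" x y "kernel (relabel f C)" "kernel C" k]
      by (intro exI[of _ k]) (simp add: relabel_def)
  qed
  then show ?thesis
    using C f by (simp add: finite_chain_iff relabel_def sum.reindex[OF f] cong: sum.cong_simp)
qed

lemma separation_relabel: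
  assumes "inj_on f (states C)" "separation_le C t \<delta>"
  shows "separation_le (relabel f C) t \<delta>"
  using assms unfolding separation_le_def
  by (auto simp: stat_relabel heat_relabel)

section \<open>Chains that resample from the stationary distribution\<close>

definition resampling_chain :: "'a set \<Rightarrow> ('a \<Rightarrow> real) \<Rightarrow> 'a chain" where
  "resampling_chain S \<mu> = \<lparr> states = S, kernel = (\<lambda>x y. \<mu> y), stat = \<mu> \<rparr>"

lemma resampling_chain_simps [simp]:
  "states (resampling_chain S \<mu>) = S" "kernel (resampling_chain S \<mu>) x y = \<mu> y"
  "stat (resampling_chain S \<mu>) = \<mu>"
  by (simp_all add: resampling_chain_def)

lemma finite_chain_resampling:
  assumes S: "finite S" and pos: "\<And>x. x \<in> S \<Longrightarrow> 0 < \<mu> x" and total: "(\<Sum>x\<in>S. \<mu> x) = 1"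
  shows "finite_chain (resampling_chain S \<mu>)"
proof -
  have "0 < mat_pow S (\<lambda>x. \<mu>) (Suc 0) x y" if "y \<in> S" for x y
    using S pos that by (simp add: mat_mul_finite)
  then have "irreducible_matrix S (\<lambda>x. \<mu>)"
    unfolding irreducible_matrix_def by blast
  then show ?thesis
    using S pos total
    by (auto simp: finite_chain_iff resampling_chain_def less_imp_le sum_distrib_right[symmetric])
qed

text \<open>
  The state is redrawn from \<open>\<mu>\<close> at the rings of a clock of rate \<open>1\<close>, so the start is remembered
  exactly up to the first ring, which comes after time \<open>t\<close> with probability \<open>e\<^sup>-\<^sup>t\<close>.
\<close>

lemma heat_resampling:
  assumes S: "finite S" and total: "(\<Sum>x\<in>S. \<mu> x) = 1" and xy: "x \<in> S" "y \<in> S"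
  shows "heat (resampling_chain S \<mu>) t x y = exp (- t) * mat_id x y + (1 - exp (- t)) * \<mu> y"
proof (rule heat_unique[where G = "\<lambda>t x y. exp (- t) * mat_id x y + (1 - exp (- t)) * \<mu> y"])
  fix t z assume "z \<in> states (resampling_chain S \<mu>)"
  have "(\<Sum>w\<in>S. exp (- t) * mat_id x w + (1 - exp (- t)) * \<mu> w) = 1"
    using S xy total by (simp add: sum.distrib sum_distrib_left[symmetric])
  then have "(\<Sum>w\<in>S. (exp (- t) * mat_id x w + (1 - exp (- t)) * \<mu> w) * \<mu> z) = \<mu> z"
    by (simp add: sum_distrib_right[symmetric])
  then show "((\<lambda>t. exp (- t) * mat_id x z + (1 - exp (- t)) * \<mu> z) has_real_derivative
      (\<Sum>w\<in>states (resampling_chain S \<mu>). (exp (- t) * mat_id x w + (1 - exp (- t)) * \<mu> w) *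
         kernel (resampling_chain S \<mu>) w z) -
      (exp (- t) * mat_id x z + (1 - exp (- t)) * \<mu> z)) (at t)"
    by (auto intro!: derivative_eq_intros simp: algebra_simps)
qed (use S xy in auto)

lemma separation_resampling:
  assumes "finite S" "(\<Sum>x\<in>S. \<mu> x) = 1"
  shows "separation_le (resampling_chain S \<mu>) t (exp (- t))"
  using assms by (auto simp: separation_le_def heat_resampling mat_id_def)

text \<open>
  The chain of index \<open>n\<close> has a state of mass \<open>2\<^sup>-\<^sup>n\<close>. Observing that a coordinate sits in that state
  is almost certain evidence that it has not been resampled since a start there.
\<close>

definition rare_mass :: "nat \<Rightarrow> nat \<Rightarrow> real" where
  "rare_mass n x = (if x = 0 then (1/2) ^ n else 1 - (1/2) ^ n)"

definition rare_state_chain :: "nat \<Rightarrow> nat chain" where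
  "rare_state_chain n = resampling_chain {0, 1} (rare_mass n)"

lemma states_rare [simp]: "states (rare_state_chain n) = {0, 1}"
  and stat_rare [simp]: "stat (rare_state_chain n) = rare_mass n"
  by (simp_all add: rare_state_chain_def)

lemma rare_mass_total: "(\<Sum>x\<in>{0, 1}. rare_mass n x) = 1"
  by (simp add: rare_mass_def)

lemma heat_rare:
  assumes "x \<in> {0, 1}" "y \<in> {0, 1}"
  shows "heat (rare_state_chain n) t x y = exp (- t) * mat_id x y + (1 - exp (- t)) * rare_mass n y"
  unfolding rare_state_chain_def using assms rare_mass_total by (intro heat_resampling) auto

lemma half_pow_less_1: "1 \<le> n \<Longrightarrow> (1/2 :: real) ^ n < 1"
  by (simp add: power_less_one_iff)

lemma finite_chain_rare:
  assumes "1 \<le> n"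
  shows "finite_chain (rare_state_chain n)"
  unfolding rare_state_chain_def
  using half_pow_less_1[OF assms] rare_mass_total
  by (intro finite_chain_resampling) (auto simp: rare_mass_def)

lemma separation_rare: "separation_le (rare_state_chain n) t (exp (- t))"
  unfolding rare_state_chain_def using rare_mass_total by (intro separation_resampling) auto

lemma tv_rare_le:
  assumes "1 \<le> n"
  shows "tv_distance (continuous_time (rare_state_chain n)) t \<le> exp (- t)"
  using assms by (intro tv_distance_le_separation finite_chain_rare separation_rare) auto

lemma tv_rare_ge:
  assumes n: "1 \<le> n" and t: "0 \<le> t"
  shows "exp (- t) / 2 \<le> tv_distance (continuous_time (rare_state_chain n)) t"
proof -
  have "(1/2 :: real) ^ n \<le> (1/2) ^ 1" using n by (intro power_decreasing) auto
  then have "exp (- t) / 2 \<le> exp (- t) * (1 - (1/2) ^ n)" by simp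
  also have "\<dots> = (\<Sum>y\<in>{0}. heat (rare_state_chain n) t 0 y) - (\<Sum>y\<in>{0}. stat (rare_state_chain n) y)"
    by (simp add: heat_rare mat_id_def rare_mass_def algebra_simps)
  also have "\<dots> \<le> tv_distance (continuous_time (rare_state_chain n)) t"
    by (intro tv_distance_ge finite_chain_rare n t) auto
  finally show ?thesis .
qed

abbreviation rare_product :: "nat \<Rightarrow> (nat \<Rightarrow> nat) chain" where
  "rare_product \<equiv> product_family rare_state_chain (\<lambda>_. 1)"

lemma finite_chain_rare_product: "1 \<le> n \<Longrightarrow> finite_chain (rare_product n)"
  by (intro finite_chain_product finite_chain_rare) auto

lemma separation_rare_product:
  assumes "1 \<le> n" "0 \<le> t"
  shows "separation_le (rare_product n) t (real n * exp (- t / real n))"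
proof -
  have "separation_le (rare_product n) t (\<Sum>j=1..n. exp (- t / real n))"
    using assms separation_rare[of _ "t / real n"]
    by (intro separation_product finite_chain_rare) auto
  then show ?thesis by simp
qed

lemma sum_half_powers_le:
  assumes "m \<le> n"
  shows "(\<Sum>j\<in>{m<..n}. (1/2 :: real) ^ j) \<le> (1/2) ^ m"
proof -
  have "(\<Sum>j\<in>{m<..n}. (1/2 :: real) ^ j) = (1/2) ^ m - (1/2) ^ n"
    using assms
  proof (induction n rule: dec_induct)
    case (step n)
    then have "{m<..Suc n} = insert (Suc n) {m<..n}" by auto
    then show ?case using step by simp
  qed simp
  then show ?thesis by simp
qed

text \<open>
  The distinguishing event is that some coordinate \<open>j > m\<close> sits in its rare state. Under the
  stationary distribution it has probability at most \<open>2\<^sup>-\<^sup>m\<close>; started from all coordinates in their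
  rare states, it fails only if every one of the \<open>n - m\<close> coordinates has been resampled.
\<close>

lemma tv_rare_product_ge:
  assumes n: "1 \<le> n" and m: "m \<le> n" and t: "0 \<le> t"
  shows "1 - (1/2) ^ m - (1 - exp (- t / real n)) ^ (n - m)
       \<le> tv_distance (continuous_time (rare_product n)) t"
proof -
  let ?P = "rare_product n"
  let ?S = "states ?P"
  define x :: "nat \<Rightarrow> nat" where "x = (\<lambda>j\<in>{1..n}. 0)"
  define B :: "nat \<Rightarrow> nat set" where "B j = (if m < j then {1} else {0, 1})" for j
  let ?B = "PiE {1..n} B"
  have C: "finite_chain ?P" using n by (rule finite_chain_rare_product)
  have fin: "finite ?S" using C by (simp add: finite_chain_iff)
  have x: "x \<in> ?S" by (auto simp: x_def)
  have BS: "?B \<subseteq> ?S" unfolding states_product by (rule PiE_mono) (auto simp: B_def)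
  have restrict: "(\<Prod>j=1..n. if m < j then f j else 1) = (\<Prod>j\<in>{m<..n}. f j)" for f :: "nat \<Rightarrow> real"
    by (simp add: prod.If_cases) (rule prod.cong; auto)
  have "(\<Sum>y\<in>?B. heat ?P t x y)
      = (\<Prod>j=1..n. \<Sum>z\<in>B j. heat (rare_state_chain j) (1 / (\<Sum>j=1..n. 1) * t) (x j) z)"
    using n by (intro heat_product_box x) (auto simp: B_def)
  also have "\<dots> = (\<Prod>j=1..n. if m < j then (1 - exp (- t / real n)) * (1 - (1/2) ^ j) else 1)"
    by (intro prod.cong refl) (auto simp: B_def x_def heat_rare mat_id_def rare_mass_def algebra_simps)
  also have "\<dots> = (\<Prod>j\<in>{m<..n}. (1 - exp (- t / real n)) * (1 - (1/2) ^ j))"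
    by (rule restrict)
  also have "\<dots> \<le> (\<Prod>j\<in>{m<..n}. 1 - exp (- t / real n))"
    using t by (intro prod_mono) (auto simp: power_le_one intro!: mult_left_le)
  finally have H: "(\<Sum>y\<in>?B. heat ?P t x y) \<le> (1 - exp (- t / real n)) ^ (n - m)" by simp
  have "1 - (1/2) ^ m \<le> 1 - (\<Sum>j\<in>{m<..n}. (1/2 :: real) ^ j)"
    using sum_half_powers_le[OF m] by simp
  also have "\<dots> \<le> (\<Prod>j\<in>{m<..n}. 1 - (1/2) ^ j)"
    by (intro one_minus_sum_le_prod) (auto simp: power_le_one)
  also have "\<dots> = (\<Prod>j=1..n. if m < j then 1 - (1/2) ^ j else 1)"
    by (rule restrict[symmetric])
  also have "\<dots> = (\<Prod>j=1..n. \<Sum>z\<in>B j. stat (rare_state_chain j) z)"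
    by (intro prod.cong refl) (auto simp: B_def rare_mass_def)
  also have "\<dots> = (\<Sum>y\<in>?B. stat ?P y)"
    by (intro stat_product_box[symmetric]) (auto simp: B_def)
  finally have \<pi>: "1 - (1/2) ^ m \<le> (\<Sum>y\<in>?B. stat ?P y)" .
  have "(\<Sum>y\<in>?S - ?B. heat ?P t x y) - (\<Sum>y\<in>?S - ?B. stat ?P y)
      = (\<Sum>y\<in>?B. stat ?P y) - (\<Sum>y\<in>?B. heat ?P t x y)"
    using sum_diff[OF fin BS, of "heat ?P t x"] sum_diff[OF fin BS, of "stat ?P"]
      heat_sum[OF C x, of t] C by (simp add: finite_chain_iff del: stat_product states_product)
  moreover have "\<dots> \<le> tv_distance (continuous_time ?P) t"
    unfolding calculation[symmetric] by (rule tv_distance_ge[OF C t x]) auto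
  ultimately show ?thesis using H \<pi> by linarith
qed

text \<open>
  At time \<open>a n ln (n + 1)\<close> each of the \<open>n\<close> coordinates is still unsampled with probability
  \<open>(n + 1)\<^sup>-\<^sup>a\<close>, so the expected number of such coordinates tends to \<open>0\<close> for \<open>a > 1\<close> and to infinity
  for \<open>a < 1\<close>. The shift in the logarithm keeps the cutoff time positive at \<open>n = 1\<close>.
\<close>

lemma tv_cutoff_rare_product: "tv_cutoff (ct_family rare_product)"
  unfolding tv_cutoff_def ct_family_def
proof (intro exI conjI allI impI)
  let ?t = "\<lambda>n. real n * ln (real n + 1)"
  let ?d = "\<lambda>a n. tv_distance (continuous_time (rare_product n)) (a * ?t n)"
  show "0 < ?t n" if "1 \<le> n" for n using that by simp
  show "?d a \<longlonglongrightarrow> 0" if a: "1 < a" for a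
  proof (rule tendsto_sandwich)
    have t: "0 \<le> a * ?t n" for n using a by simp
    show "\<forall>\<^sub>F n in sequentially. ?d a n \<le> real n * exp (- (a * ln (real n + 1)))"
      using eventually_ge_at_top[of 1]
    proof eventually_elim
      case (elim n)
      then show ?case
        using separation_rare_product[OF elim t, of n] finite_chain_rare_product[OF elim]
        by (intro tv_distance_le_separation) auto
    qed
    show "\<forall>\<^sub>F n in sequentially. 0 \<le> ?d a n"
      using eventually_ge_at_top[of 1]
    proof eventually_elim
      case (elim n)
      have C: "finite_chain (rare_product n)" using elim by (rule finite_chain_rare_product)
      obtain x where "x \<in> states (rare_product n)" using finite_chain_states_nonempty[OF C] by blast
      from tv_distance_ge[OF C t this, of "{}" n] show ?case by simp
    qed
    show "(\<lambda>n. real n * exp (- (a * ln (real n + 1)))) \<longlonglongrightarrow> 0"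
      using a by real_asymp
  qed simp
  show "?d a \<longlonglongrightarrow> 1" if a: "0 < a \<and> a < 1" for a
  proof (rule tendsto_sandwich)
    have t: "0 \<le> a * ?t n" for n using a by simp
    let ?l = "\<lambda>n. 1 - (1/2) ^ (n div 2) - exp (- exp (- (a * ln (real n + 1))) * (real n / 2))"
    show "\<forall>\<^sub>F n in sequentially. ?l n \<le> ?d a n"
      using eventually_ge_at_top[of 1]
    proof eventually_elim
      case (elim n)
      let ?u = "exp (- (a * ln (real n + 1)))"
      have u: "?u \<le> 1" using a by simp
      have "(1 - ?u) ^ (n - n div 2) \<le> exp (- ?u) ^ (n - n div 2)"
        using u exp_ge_add_one_self[of "- ?u"] by (intro power_mono) auto
      also have "\<dots> = exp (- ?u * real (n - n div 2))"
        by (simp add: exp_of_nat_mult[symmetric] mult_ac)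
      also have "\<dots> \<le> exp (- ?u * (real n / 2))"
        by (auto simp: of_nat_diff intro!: mult_left_mono)
      finally show ?case
        \<comment> \<open>Half of the coordinates suffice to see an unsampled one; their rare masses sum to \<open>o(1)\<close>.\<close>
        using tv_rare_product_ge[OF elim _ t, of "n div 2" n] elim by simp
    qed
    show "\<forall>\<^sub>F n in sequentially. ?d a n \<le> 1"
      using eventually_ge_at_top[of 1]
    proof eventually_elim
      case (elim n)
      have C: "finite_chain (rare_product n)" using elim by (rule finite_chain_rare_product)
      then have "separation_le (rare_product n) (a * ?t n) 1"
        using t[of n] by (auto simp: separation_le_def intro!: heat_nonneg)
      then show ?case using C by (intro tv_distance_le_separation) auto
    qed
    have "filterlim (\<lambda>n::nat. n div 2) at_top at_top"
      unfolding filterlim_at_top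
    proof
      fix Z :: nat
      show "\<forall>\<^sub>F n in sequentially. Z \<le> n div 2"
        using eventually_ge_at_top[of "2 * Z"] by eventually_elim auto
    qed
    then have "(\<lambda>n. (1/2 :: real) ^ (n div 2)) \<longlonglongrightarrow> 0"
      by (intro filterlim_compose[OF LIMSEQ_realpow_zero]) auto
    moreover have "(\<lambda>n. exp (- exp (- (a * ln (real n + 1))) * (real n / 2))) \<longlonglongrightarrow> 0"
      using a by real_asymp
    ultimately have "?l \<longlonglongrightarrow> 1 - 0 - 0" by (intro tendsto_diff tendsto_const)
    then show "?l \<longlonglongrightarrow> 1" by simp
  qed simp
qed

section \<open>Absence of cutoff\<close>

text \<open>
  A distance that stays above \<open>b\<close> until time \<open>4 r\<^sub>n\<close> forces any cutoff time to exceed \<open>2 r\<^sub>n\<close>, but at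
  half such a time the distance is already at most \<open>c < 1\<close>.
\<close>

lemma not_tv_cutoff_if_gradual:
  assumes c: "c < 1" "\<And>n t. 1 \<le> n \<Longrightarrow> r n \<le> t \<Longrightarrow> tv_distance (G n) t \<le> c"
    and b: "0 < b" "\<And>n t. 1 \<le> n \<Longrightarrow> 0 < t \<Longrightarrow> t \<le> 4 * r n \<Longrightarrow> b \<le> tv_distance (G n) t"
  shows "\<not> tv_cutoff G"
proof
  assume "tv_cutoff G"
  then obtain t :: "nat \<Rightarrow> real" where t: "\<And>n. 1 \<le> n \<Longrightarrow> 0 < t n"
    and lim0: "\<And>a. 1 < a \<Longrightarrow> (\<lambda>n. tv_distance (G n) (a * t n)) \<longlonglongrightarrow> 0"
    and lim1: "\<And>a. 0 < a \<Longrightarrow> a < 1 \<Longrightarrow> (\<lambda>n. tv_distance (G n) (a * t n)) \<longlonglongrightarrow> 1"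
    unfolding tv_cutoff_def by blast
  have "\<forall>\<^sub>F n in sequentially. tv_distance (G n) (2 * t n) < b"
    using order_tendstoD(2)[OF lim0 b(1)] by simp
  moreover have "\<forall>\<^sub>F n in sequentially. c < tv_distance (G n) (1/2 * t n)"
    using c(1) by (intro order_tendstoD(1)[OF lim1]) auto
  ultimately have "\<forall>\<^sub>F n::nat in sequentially. False"
    using eventually_ge_at_top[of 1]
  proof eventually_elim
    case (elim n)
    have "4 * r n < 2 * t n" using b(2)[of n "2 * t n"] t[of n] elim by force
    then have "tv_distance (G n) (1/2 * t n) \<le> c" using elim by (intro c(2)) auto
    then show False using elim by simp
  qed
  then show False by simp
qed

lemma not_tv_cutoff_rare: "\<not> tv_cutoff (ct_family rare_state_chain)"
proof (rule not_tv_cutoff_if_gradual[where r = "\<lambda>_. 1" and c = "exp (- 1)" and b = "exp (- 4) / 2"])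
  fix n :: nat and t :: real assume n: "1 \<le> n"
  show "tv_distance (ct_family rare_state_chain n) t \<le> exp (- 1)" if "1 \<le> t"
    using tv_rare_le[OF n, of t] that by (auto simp: ct_family_def intro: order_trans)
  show "exp (- 4) / 2 \<le> tv_distance (ct_family rare_state_chain n) t" if "0 < t" "t \<le> 4 * 1"
    using tv_rare_ge[OF n, of t] that by (auto simp: ct_family_def intro: order_trans[rotated])
qed auto

section \<open>A slow factor that hides the cutoff of the others\<close>

definition coded_product :: "nat \<Rightarrow> nat chain" where
  "coded_product n = relabel (to_nat_on (states (rare_product n))) (rare_product n)"

lemma inj_on_code: "inj_on (to_nat_on (states (rare_product n))) (states (rare_product n))"
  by (intro inj_on_to_nat_on countable_finite) (auto intro!: finite_PiE)

lemma finite_chain_coded: "1 \<le> n \<Longrightarrow> finite_chain (coded_product n)"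
  unfolding coded_product_def by (intro finite_chain_relabel inj_on_code finite_chain_rare_product)

lemma tv_coded: "tv_distance (continuous_time (coded_product n)) t
    = tv_distance (continuous_time (rare_product n)) t"
  unfolding coded_product_def by (rule tv_distance_relabel[OF inj_on_code])

lemma tv_cutoff_coded: "tv_cutoff (ct_family coded_product)"
  using tv_cutoff_rare_product by (simp add: tv_cutoff_def ct_family_def tv_coded)

text \<open>
  Time \<open>3 n\<^sup>2\<close> is well past the cutoff time \<open>n ln (n + 1)\<close>, far enough for the separations to be
  summable over \<open>n\<close>.
\<close>

lemma separation_coded:
  assumes n: "1 \<le> n" and t: "3 * (real n)\<^sup>2 \<le> t"
  shows "separation_le (coded_product n) t ((1/4) ^ n)"
proof -
  have "0 \<le> t" using t by (rule order_trans[rotated]) simp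
  have "(8::real) = 2 ^ 3" by simp
  also have "\<dots> \<le> exp 1 ^ 3" using exp_ge_add_one_self[of 1] by (intro power_mono) auto
  also have "\<dots> = exp 3" by (simp add: exp_of_nat_mult[symmetric])
  finally have e: "exp (- 3) \<le> (1/8 :: real)" by (simp add: exp_minus field_simps)
  have "real n * exp (- t / real n) \<le> real n * exp (- 3) ^ n"
    using n t by (simp add: exp_of_nat_mult[symmetric] field_simps power2_eq_square)
  also have "\<dots> \<le> 2 ^ n * (1/8) ^ n"
    using e of_nat_less_two_power[of n, where 'a = real]
    by (intro mult_mono power_mono) (auto simp: less_imp_le)
  also have "\<dots> = (1/4) ^ n" by (simp add: power_mult_distrib[symmetric])
  finally have "separation_le (rare_product n) t ((1/4) ^ n)"
    using n \<open>0 \<le> t\<close>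
    by (intro separation_le_mono[OF _ separation_rare_product] finite_chain_rare_product) auto
  then show ?thesis unfolding coded_product_def by (rule separation_relabel[OF inj_on_code])
qed

lemma sum_quarter_powers_le: "(\<Sum>j=1..n. (1/4 :: real) ^ j) \<le> 1/2"
proof -
  have "(\<Sum>j=1..n. (1/4 :: real) ^ j) = (1 - (1/4) ^ n) / 3"
    by (induction n) (simp_all add: diff_divide_distrib)
  also have "\<dots> \<le> 1/2" by (rule order_trans[of _ "1/3"]) auto
  finally show ?thesis .
qed

text \<open>
  With weights \<open>p\<^sub>j = j\<^sup>2\<close>, at product time \<open>s q\<^sub>n\<close> the \<open>j\<close>-th factor has run for time \<open>s j\<^sup>2\<close>. For
  \<open>s \<ge> 3\<close> all factors together leave a distance of at most \<open>1/2\<close>, while the first one alone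
  contributes at least \<open>e\<^sup>-\<^sup>s/2\<close>, independently of \<open>n\<close>.
\<close>

lemma not_tv_cutoff_product_coded:
  "\<not> tv_cutoff (ct_family (product_family coded_product (\<lambda>n. (real n)\<^sup>2)))"
proof -
  define q where "q n = (\<Sum>j=1..n. (real j)\<^sup>2)" for n
  let ?P = "product_family coded_product (\<lambda>n. (real n)\<^sup>2)"
  have C: "finite_chain (coded_product j)" if "j \<in> {1..n}" for j n
    using that by (intro finite_chain_coded) auto
  have p: "0 < (real j)\<^sup>2" if "j \<in> {1..n}" for j n using that by auto
  have q: "0 < q n" if "1 \<le> n" for n unfolding q_def using that p by (intro sum_pos) auto
  have CP: "finite_chain (?P n)" if "1 \<le> n" for n
    using that C p by (intro finite_chain_product) auto
  have "\<not> tv_cutoff (\<lambda>n. continuous_time (?P n))"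
  proof (rule not_tv_cutoff_if_gradual[where r = "\<lambda>n. 3 * q n" and c = "1/2" and b = "exp (- 12) / 2"])
    fix n :: nat and t :: real assume n: "1 \<le> n"
    show "tv_distance (continuous_time (?P n)) t \<le> 1/2" if t: "3 * q n \<le> t"
    proof -
      have "separation_le (?P n) t (\<Sum>j=1..n. (1/4) ^ j)"
      proof (rule separation_product)
        show "separation_le (coded_product j) ((real j)\<^sup>2 / (\<Sum>j=1..n. (real j)\<^sup>2) * t) ((1/4) ^ j)"
          if j: "j \<in> {1..n}" for j
        proof (rule separation_coded)
          have "3 * (real j)\<^sup>2 = (real j)\<^sup>2 / q n * (3 * q n)" using q[OF n] by simp
          also have "\<dots> \<le> (real j)\<^sup>2 / q n * t" using t q[OF n] by (intro mult_left_mono) auto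
          finally show "3 * (real j)\<^sup>2 \<le> (real j)\<^sup>2 / (\<Sum>j=1..n. (real j)\<^sup>2) * t"
            by (simp add: q_def)
        qed (use j in auto)
      qed (use C p n in \<open>auto simp: power_le_one\<close>)
      then have "separation_le (?P n) t (1/2)"
        by (rule separation_le_mono[OF CP[OF n] _ sum_quarter_powers_le])
      then show ?thesis using CP[OF n] by (intro tv_distance_le_separation) auto
    qed
    show "exp (- 12) / 2 \<le> tv_distance (continuous_time (?P n)) t"
      if t: "0 < t" "t \<le> 4 * (3 * q n)"
    proof -
      have tq: "0 \<le> t / q n" "t / q n \<le> 12" using t q[OF n] by (auto simp: field_simps)
      then have "exp (- 12) / 2 \<le> exp (- (t / q n)) / 2" by simp
      also have "\<dots> \<le> tv_distance (continuous_time (rare_state_chain 1)) (t / q n)"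
        using tq by (intro tv_rare_ge) auto
      also have "\<dots> \<le> tv_distance (continuous_time (rare_product 1)) (t / q n)"
        using tv_product_ge_factor[of 1 rare_state_chain "\<lambda>_. 1" 1 "t / q n"] tq finite_chain_rare[of 1]
        by simp
      also have "\<dots> = tv_distance (continuous_time (coded_product 1)) (t / q n)"
        by (rule tv_coded[symmetric])
      also have "\<dots> \<le> tv_distance (continuous_time (?P n)) t"
        using tv_product_ge_factor[of n coded_product "\<lambda>n. (real n)\<^sup>2" 1 t, OF C[where n = n] p[where n = n]] n t
        by (simp add: q_def)
      finally show ?thesis .
    qed
  qed auto
  then show ?thesis by (simp add: ct_family_def[abs_def])
qed

section \<open>Cutoff passes neither to products nor back to factors\<close>

theorem theorem1p5:
  "(\<exists>(F :: nat \<Rightarrow> nat chain) (p :: nat \<Rightarrow> real).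
      (\<forall>n\<ge>1. irreducible_markov_chain (F n)) \<and> (\<forall>n\<ge>1. p n > 0) \<and>
      \<not> tv_cutoff (ct_family F) \<and> tv_cutoff (ct_family (product_family F p)))
   \<and>
   (\<exists>(F :: nat \<Rightarrow> nat chain) (p :: nat \<Rightarrow> real).
      (\<forall>n\<ge>1. irreducible_markov_chain (F n)) \<and> (\<forall>n\<ge>1. p n > 0) \<and>
      tv_cutoff (ct_family F) \<and> \<not> tv_cutoff (ct_family (product_family F p)))"
proof (intro conjI exI)
  show "\<forall>n\<ge>1. irreducible_markov_chain (rare_state_chain n)"
    using finite_chain_rare by (simp add: finite_chain_def)
  show "tv_cutoff (ct_family rare_product)" by (rule tv_cutoff_rare_product)
  show "\<forall>n\<ge>1. irreducible_markov_chain (coded_product n)"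
    using finite_chain_coded by (simp add: finite_chain_def)
  show "\<not> tv_cutoff (ct_family (product_family coded_product (\<lambda>n. (real n)\<^sup>2)))"
    by (rule not_tv_cutoff_product_coded)
qed (auto simp: not_tv_cutoff_rare tv_cutoff_coded)

end
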